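(* Let $X$ and $Y$ be complex Banach spaces. Let $T \in \mathcal{L}(X)$, $S \in \mathcal{L}(Y,X)$, and $p > 0$. Then the following statements hold: a) Assume that $T$ is power-bounded. If there exist functions $f,G\colon \mathbb{N} \to (0,\infty)$ such that $$\sum_{m=1}^{n} f(m) \|T^mSy\|^p \leq G(n) \|y\|^p$$ for all $n \in \mathbb{N}$ and $y \in Y$, then $$\|T^nS\| \leq \frac{K\,G(n)^{1/p}}{F(n)^{1/p}}$$ for all $n \in \mathbb{N}$, where $K := \sup_{n \in \mathbb{N}\cup\{0\}} \|T^n\|$ and $F(n) := \sum_{m=1}^n f(m)$. b) Let $f,g\colon (0,\infty) \to (0,\infty)$ be $\alpha$-bounded regularly varying for some constant $\alpha \geq 0$. Define $$F(n) := \sum_{m=1}^n f(m)g(m)\quad \text{and} \quad G(n) := \sum_{m=1}^{n} \frac{1}{m\,g(m)}$$ for $n \in \mathbb{N}$. If $\|T^nS\| = O(1/F(n)^{1/p})$ as $n \to \infty$, then there exists a constant $C>0$ such that $$\sum_{m=1}^n f(m) \|T^m Sy\|^p \leq C\,G(n) \|y\|^p$$ for all $n \in \mathbb{N}$ and $y \in Y$.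
   Context: $\mathcal{L}(Y,X)$ denotes the space of bounded linear operators from $Y$ to $X$, and $\mathcal{L}(X)=\mathcal{L}(X,X)$. An operator $T \in \mathcal{L}(X)$ is power-bounded if $\sup_{n \ge 0}\|T^n\| < \infty$. $\mathbb{N}$ is the set of positive integers. For $\alpha \ge 0$, a function $f \colon (0,\infty) \to (0,\infty)$ is called $\alpha$-bounded regularly varying if there exists $t_0>0$ such that $f$ is non-decreasing on $[t_0,\infty)$, is absolutely continuous on each compact subinterval of $[t_0,\infty)$, and satisfies $t f'(t)/f(t) \le \alpha$ for a.e. $t \ge t_0$. $a(n) = O(b(n))$ as $n\to\infty$ means there are constants $K>0$, $n_0$ with $a(n)\le K b(n)$ for all $n \ge n_0$. *)

theory Defs
  imports "HOL-Analysis.Analysis" "HOL-Library.Landau_Symbols"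
begin

(* HOL-Analysis has no complex normed spaces: the real Banach space structure is
   extended by a compatible complex scalar multiplication. *)
class complex_banach = banach +
  fixes scaleC :: "complex \<Rightarrow> 'a \<Rightarrow> 'a" (infixr \<open>*\<^sub>C\<close> 75)
  assumes scaleC_of_real: "complex_of_real r *\<^sub>C x = r *\<^sub>R x"
    and scaleC_add_right: "c *\<^sub>C (x + y) = c *\<^sub>C x + c *\<^sub>C y"
    and scaleC_add_left: "(c + d) *\<^sub>C x = c *\<^sub>C x + d *\<^sub>C x"
    and scaleC_scaleC: "c *\<^sub>C d *\<^sub>C x = (c * d) *\<^sub>C x"
    and norm_scaleC: "norm (c *\<^sub>C x) = cmod c * norm x"

instantiation complex :: complex_banach
begin

definition scaleC_complex :: "complex \<Rightarrow> complex \<Rightarrow> complex" where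
  "scaleC_complex c x = c * x"

instance
  by standard (auto simp: scaleC_complex_def scaleR_conv_of_real algebra_simps norm_mult)

end

definition bounded_clinear :: "('a::complex_banach \<Rightarrow> 'b::complex_banach) \<Rightarrow> bool" where
  "bounded_clinear A \<longleftrightarrow> bounded_linear A \<and> (\<forall>c x. A (c *\<^sub>C x) = c *\<^sub>C A x)"

definition power_bounded :: "('a::complex_banach \<Rightarrow> 'a) \<Rightarrow> bool" where
  "power_bounded T \<longleftrightarrow> bdd_above (range (\<lambda>n::nat. onorm (T ^^ n)))"

(* Absolute continuity of a real function; HOL-Analysis only has the notion for measures. *)
definition absolutely_continuous_on_Icc :: "real \<Rightarrow> real \<Rightarrow> (real \<Rightarrow> real) \<Rightarrow> bool" where
  "absolutely_continuous_on_Icc a b f \<longleftrightarrow>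
     (\<forall>\<epsilon>>0. \<exists>\<delta>>0. \<forall>(N::nat) u v.
        (\<forall>i<N. a \<le> u i \<and> u i \<le> v i \<and> v i \<le> b) \<longrightarrow>
        disjoint_family_on (\<lambda>i. {u i<..<v i}) {..<N} \<longrightarrow>
        (\<Sum>i<N. v i - u i) < \<delta> \<longrightarrow>
        (\<Sum>i<N. \<bar>f (v i) - f (u i)\<bar>) < \<epsilon>)"

(* A function from (0,\<infinity>) to (0,\<infinity>) is represented by a total function on the reals whose
   values at non-positive arguments are irrelevant. *)
definition bounded_regularly_varying :: "real \<Rightarrow> (real \<Rightarrow> real) \<Rightarrow> bool" where
  "bounded_regularly_varying \<alpha> f \<longleftrightarrow>
     (\<forall>t>0. f t > 0) \<and>
     (\<exists>t\<^sub>0>0.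
        mono_on {t\<^sub>0..} f \<and>
        (\<forall>a b. t\<^sub>0 \<le> a \<longrightarrow> a \<le> b \<longrightarrow> absolutely_continuous_on_Icc a b f) \<and>
        (AE t in lborel. t \<ge> t\<^sub>0 \<longrightarrow>
           (\<exists>D. (f has_real_derivative D) (at t) \<and> t * D / f t \<le> \<alpha>)))"

end

theory Submission
  imports Defs
begin

text \<open>
  (a) Power-boundedness gives \<open>\<parallel>T\<^sup>n S y\<parallel> \<le> K \<parallel>T\<^sup>m S y\<parallel>\<close> for \<open>m \<le> n\<close>; average the \<open>p\<close>-th powers with the
  weights \<open>f m\<close>.

  (b) For an \<open>\<alpha>\<close>-bounded regularly varying \<open>f\<close> the function \<open>ln (f t) - \<alpha> ln t\<close> is absolutely
  continuous with a.e. non-positive derivative, hence non-increasing, so \<open>f\<close> and \<open>g\<close> grow by a factor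
  of at most \<open>2\<^sup>\<alpha>\<close> between \<open>m/2\<close> and \<open>m\<close>. Keeping only the terms with index at least \<open>m/2\<close> in \<open>F m\<close>
  then yields \<open>m f(m) g(m) \<le> C F(m)\<close>, that is, \<open>f(m) / F(m) \<le> C / (m g(m))\<close>.
\<close>

section \<open>Absolutely continuous functions\<close>

text \<open>The definition indexes its intervals by an initial segment of the naturals, whereas a
  tagged division is a set of tag-interval pairs. Sums and disjointness are invariant under
  reindexing by a bijection with \<open>{..<card I}\<close>.\<close>

lemma absolutely_continuous_on_Icc_finite:
  assumes "absolutely_continuous_on_Icc a b f" "\<epsilon> > 0"
  obtains \<delta> where "\<delta> > 0"
    "\<And>(I :: 'i set) u v. finite I \<Longrightarrow> (\<And>i. i \<in> I \<Longrightarrow> a \<le> u i \<and> u i \<le> v i \<and> v i \<le> b) \<Longrightarrow>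
       disjoint_family_on (\<lambda>i. {u i<..<v i}) I \<Longrightarrow> (\<Sum>i\<in>I. v i - u i) < \<delta> \<Longrightarrow>
       (\<Sum>i\<in>I. \<bar>f (v i) - f (u i)\<bar>) < \<epsilon>"
proof -
  obtain \<delta> where "\<delta> > 0" and \<delta>: "\<And>(N::nat) u v. (\<forall>i<N. a \<le> u i \<and> u i \<le> v i \<and> v i \<le> b) \<Longrightarrow>
        disjoint_family_on (\<lambda>i. {u i<..<v i}) {..<N} \<Longrightarrow> (\<Sum>i<N. v i - u i) < \<delta> \<Longrightarrow>
        (\<Sum>i<N. \<bar>f (v i) - f (u i)\<bar>) < \<epsilon>"
    using assms unfolding absolutely_continuous_on_Icc_def by meson
  show thesis
  proof (rule that[OF \<open>\<delta> > 0\<close>])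
    fix I :: "'i set" and u v
    assume I: "finite I" and uv: "\<And>i. i \<in> I \<Longrightarrow> a \<le> u i \<and> u i \<le> v i \<and> v i \<le> b"
      and disj: "disjoint_family_on (\<lambda>i. {u i<..<v i}) I" and small: "(\<Sum>i\<in>I. v i - u i) < \<delta>"
    obtain h where h: "bij_betw h {..<card I} I"
      using ex_bij_betw_nat_finite[OF I] by (auto simp: atLeast0LessThan)
    have inI: "h i \<in> I" if "i < card I" for i
      using h that by (auto simp: bij_betw_def)
    have "disjoint_family_on (\<lambda>i. {u (h i)<..<v (h i)}) {..<card I}"
      unfolding disjoint_family_on_def
    proof (intro ballI impI)
      fix i j assume ij: "i \<in> {..<card I}" "j \<in> {..<card I}" "i \<noteq> j"
      then have "h i \<noteq> h j" using h by (auto simp: bij_betw_def inj_on_def)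
      then show "{u (h i)<..<v (h i)} \<inter> {u (h j)<..<v (h j)} = {}"
        using disjoint_family_onD[OF disj] inI ij by simp
    qed
    moreover have "(\<Sum>i<card I. v (h i) - u (h i)) < \<delta>"
      using small sum.reindex_bij_betw[OF h, of "\<lambda>i. v i - u i"] by simp
    ultimately have "(\<Sum>i<card I. \<bar>f (v (h i)) - f (u (h i))\<bar>) < \<epsilon>"
      using uv inI by (intro \<delta>) auto
    then show "(\<Sum>i\<in>I. \<bar>f (v i) - f (u i)\<bar>) < \<epsilon>"
      using sum.reindex_bij_betw[OF h, of "\<lambda>i. \<bar>f (v i) - f (u i)\<bar>"] by simp
  qed
qed

text \<open>Summing the increment bound over a family of intervals controls the variation of
  \<open>h\<close> by that of \<open>f\<close> plus the total length, and both are small for short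
  families. This carries absolute continuity from \<open>f\<close> to
  \<open>ln (f t) - \<alpha> * ln t\<close>.\<close>

lemma absolutely_continuous_on_Icc_dominated:
  assumes f: "absolutely_continuous_on_Icc a b f" and "L > 0"
    and h: "\<And>u v. a \<le> u \<Longrightarrow> u \<le> v \<Longrightarrow> v \<le> b \<Longrightarrow> \<bar>h v - h u\<bar> \<le> L * (\<bar>f v - f u\<bar> + (v - u))"
  shows "absolutely_continuous_on_Icc a b h"
  unfolding absolutely_continuous_on_Icc_def
proof (intro allI impI)
  fix \<epsilon> :: real assume "\<epsilon> > 0"
  then have e: "\<epsilon> / (2 * L) > 0" using \<open>L > 0\<close> by simp
  obtain \<delta> where "\<delta> > 0" and \<delta>: "\<And>(N::nat) u v. (\<forall>i<N. a \<le> u i \<and> u i \<le> v i \<and> v i \<le> b) \<Longrightarrow>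
        disjoint_family_on (\<lambda>i. {u i<..<v i}) {..<N} \<Longrightarrow> (\<Sum>i<N. v i - u i) < \<delta> \<Longrightarrow>
        (\<Sum>i<N. \<bar>f (v i) - f (u i)\<bar>) < \<epsilon> / (2 * L)"
    using f e unfolding absolutely_continuous_on_Icc_def by meson
  show "\<exists>\<delta>>0. \<forall>(N::nat) u v. (\<forall>i<N. a \<le> u i \<and> u i \<le> v i \<and> v i \<le> b) \<longrightarrow>
        disjoint_family_on (\<lambda>i. {u i<..<v i}) {..<N} \<longrightarrow> (\<Sum>i<N. v i - u i) < \<delta> \<longrightarrow>
        (\<Sum>i<N. \<bar>h (v i) - h (u i)\<bar>) < \<epsilon>"
  \<comment> \<open>The first entry of the minimum makes the increments of \<open>f\<close> sum to
    less than \<open>\<epsilon> / (2 * L)\<close>, the second does the same for the lengths; the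
    factor \<open>L\<close> turns the two halves into \<epsilon>.\<close>
  proof (intro exI[of _ "min \<delta> (\<epsilon> / (2 * L))"] conjI allI impI)
    show "min \<delta> (\<epsilon> / (2 * L)) > 0" using e \<open>\<delta> > 0\<close> by simp
    fix N :: nat and u v :: "nat \<Rightarrow> real"
    assume uv: "\<forall>i<N. a \<le> u i \<and> u i \<le> v i \<and> v i \<le> b"
      and disj: "disjoint_family_on (\<lambda>i. {u i<..<v i}) {..<N}"
      and small: "(\<Sum>i<N. v i - u i) < min \<delta> (\<epsilon> / (2 * L))"
    have "(\<Sum>i<N. \<bar>h (v i) - h (u i)\<bar>) \<le> (\<Sum>i<N. L * (\<bar>f (v i) - f (u i)\<bar> + (v i - u i)))"
      using uv h by (intro sum_mono) auto
    also have "\<dots> = L * ((\<Sum>i<N. \<bar>f (v i) - f (u i)\<bar>) + (\<Sum>i<N. v i - u i))"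
      by (simp add: sum_distrib_left[symmetric] sum.distrib)
    also have "\<dots> < L * (\<epsilon> / (2 * L) + \<epsilon> / (2 * L))"
      using \<delta>[OF uv disj] small \<open>L > 0\<close> by (intro mult_strict_left_mono add_strict_mono) auto
    also have "\<dots> = \<epsilon>" using \<open>L > 0\<close> by (simp add: field_simps)
    finally show "(\<Sum>i<N. \<bar>h (v i) - h (u i)\<bar>) < \<epsilon>" .
  qed
qed

text \<open>A one-sided straddle lemma: subtract the first-order expansions at \<open>t\<close> of
  \<open>h v\<close> and \<open>h u\<close>. Since \<open>t\<close> lies between \<open>u\<close>
  and \<open>v\<close>, the errors add up to exactly \<eta> times \<open>(v - t) + (t - u)\<close>,
  and the linear term has the favourable sign.\<close>

lemma straddle_upper_bound:
  fixes h :: "real \<Rightarrow> real"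
  assumes "(h has_real_derivative D) (at t)" "D \<le> 0" "\<eta> > 0"
  obtains d where "d > 0"
    "\<And>u v. u \<le> t \<Longrightarrow> t \<le> v \<Longrightarrow> u \<in> ball t d \<Longrightarrow> v \<in> ball t d \<Longrightarrow> h v - h u \<le> \<eta> * (v - u)"
proof -
  obtain d where "d > 0" and d: "\<And>y. \<bar>y - t\<bar> < d \<Longrightarrow> \<bar>h y - h t - D * (y - t)\<bar> \<le> \<eta> * \<bar>y - t\<bar>"
    using assms(1,3) unfolding has_field_derivative_def has_derivative_at_alt real_norm_def by metis
  show thesis
  proof (rule that[OF \<open>d > 0\<close>])
    fix u v assume uv: "u \<le> t" "t \<le> v" "u \<in> ball t d" "v \<in> ball t d"
    have "h v - h t - D * (v - t) \<le> \<eta> * (v - t)" "h t - h u + D * (u - t) \<le> \<eta> * (t - u)"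
      using d[of v] d[of u] uv by (auto simp: dist_real_def abs_le_iff)
    moreover have "D * (v - t) \<le> 0" "D * (u - t) \<ge> 0"
      using uv \<open>D \<le> 0\<close> by (auto simp: mult_nonpos_nonneg mult_nonpos_nonpos)
    ultimately show "h v - h u \<le> \<eta> * (v - u)" by (simp add: algebra_simps)
  qed
qed

lemma sum_lengths_le_measure:
  fixes u v :: "'i \<Rightarrow> real"
  assumes "finite I" "\<And>i. i \<in> I \<Longrightarrow> u i \<le> v i" "\<And>i. i \<in> I \<Longrightarrow> {u i<..<v i} \<subseteq> U"
    and "disjoint_family_on (\<lambda>i. {u i<..<v i}) I" "U \<in> sets lborel" "emeasure lborel U < \<infinity>"
  shows "(\<Sum>i\<in>I. v i - u i) \<le> measure lborel U"
proof -
  have "(\<Sum>i\<in>I. v i - u i) = (\<Sum>i\<in>I. measure lborel {u i<..<v i})"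
    using assms(2) by (intro sum.cong) auto
  also have "\<dots> = measure lborel (\<Union>i\<in>I. {u i<..<v i})"
    using assms(1,4) by (intro measure_finite_Union[symmetric]) (auto simp: emeasure_lborel_Ioo assms(2))
  also have "\<dots> \<le> measure lborel U"
    using assms by (intro measure_mono_fmeasurable) (auto intro!: fmeasurableI sets.finite_UN)
  finally show ?thesis .
qed

text \<open>A tagged division is chosen so fine that intervals tagged outside the exceptional null set
  contribute at most a small multiple of their length, while the others lie in an open set of small
  measure and are controlled by absolute continuity.\<close>

lemma absolutely_continuous_on_Icc_nonincreasing:
  assumes "a \<le> b" and ac: "absolutely_continuous_on_Icc a b h"
    and deriv: "AE t in lborel. a \<le> t \<longrightarrow> (\<exists>D\<le>0. (h has_real_derivative D) (at t))"
  shows "h b \<le> h a"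
proof (rule field_le_epsilon)
  fix e :: real assume "e > 0"
  \<comment> \<open>The slope is chosen so that \<eta> times the total length uses at most half of
    \<open>e\<close>; the added 1 keeps the denominator positive when \<open>a = b\<close>.\<close>
  define \<eta> where "\<eta> = e / (2 * (b - a + 1))"
  have \<eta>: "\<eta> > 0" "\<eta> * (b - a) \<le> e / 2"
    using \<open>e > 0\<close> \<open>a \<le> b\<close> by (auto simp: \<eta>_def field_simps)
  have "e / 2 > 0" using \<open>e > 0\<close> by simp
  from absolutely_continuous_on_Icc_finite[OF ac this]
  obtain \<delta> where "\<delta> > 0" and \<delta>: "\<And>(I :: (real \<times> real set) set) u v. finite I \<Longrightarrow>
       (\<And>i. i \<in> I \<Longrightarrow> a \<le> u i \<and> u i \<le> v i \<and> v i \<le> b) \<Longrightarrow>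
       disjoint_family_on (\<lambda>i. {u i<..<v i}) I \<Longrightarrow> (\<Sum>i\<in>I. v i - u i) < \<delta> \<Longrightarrow>
       (\<Sum>i\<in>I. \<bar>h (v i) - h (u i)\<bar>) < e / 2"
    by blast
  obtain N where N: "N \<in> sets lborel" "emeasure lborel N = 0"
    "\<And>t. t \<notin> N \<Longrightarrow> a \<le> t \<Longrightarrow> \<exists>D\<le>0. (h has_real_derivative D) (at t)"
  proof (rule AE_E[OF deriv])
    fix N assume N: "{t \<in> space lborel. \<not> (a \<le> t \<longrightarrow> (\<exists>D\<le>0. (h has_real_derivative D) (at t)))} \<subseteq> N"
      "emeasure lborel N = 0" "N \<in> sets lborel"
    show thesis
    proof (rule that[OF N(3,2)])
      fix t assume "t \<notin> N" "a \<le> t"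
      then show "\<exists>D\<le>0. (h has_real_derivative D) (at t)" using N(1) by auto
    qed
  qed
  \<comment> \<open>Outer regularity bounds the measure of \<open>U - N\<close>; as \<open>N\<close>
    is null, the same bound holds for \<open>U\<close> itself.\<close>
  obtain U where U: "open U" "N \<subseteq> U" "emeasure lborel (U - N) < ennreal \<delta>"
    using outer_regular_lborel[of N \<delta>] N \<open>\<delta> > 0\<close> by auto
  have "emeasure lborel U = emeasure lborel (U - N)"
    using emeasure_Diff_null_set[of N lborel U] N U by (auto simp: null_sets_def)
  then have U\<delta>: "emeasure lborel U < ennreal \<delta>" using U by simp
  have "\<exists>d>0. \<forall>u v. u \<le> t \<longrightarrow> t \<le> v \<longrightarrow> u \<in> ball t d \<longrightarrow> v \<in> ball t d \<longrightarrow> h v - h u \<le> \<eta> * (v - u)"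
    if "t \<notin> N" "a \<le> t" for t
    using N(3)[OF that] straddle_upper_bound[OF _ _ \<eta>(1)] by metis
  then obtain d where d: "\<And>t. t \<notin> N \<Longrightarrow> a \<le> t \<Longrightarrow> d t > 0"
    "\<And>t u v. t \<notin> N \<Longrightarrow> a \<le> t \<Longrightarrow> u \<le> t \<Longrightarrow> t \<le> v \<Longrightarrow> u \<in> ball t (d t) \<Longrightarrow> v \<in> ball t (d t) \<Longrightarrow>
       h v - h u \<le> \<eta> * (v - u)"
    by metis
  \<comment> \<open>The gauge forces intervals tagged in \<open>N\<close> into \<open>U\<close> and
    the others into a straddle ball. The \<open>UNIV\<close> branch only makes \<gamma> a gauge on
    the whole line: tags of a division of \<open>{a..b}\<close> are never below
    \<open>a\<close>.\<close>
  define \<gamma> where "\<gamma> t = (if t \<in> N then U else if a \<le> t then ball t (d t) else UNIV)" for t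
  have "gauge \<gamma>" using U d(1) by (auto simp: gauge_def \<gamma>_def)
  then obtain P where P: "P tagged_division_of {a..b}" "\<gamma> fine P"
    using fine_division_exists[of \<gamma> a b] by auto
  have "finite P" using P by auto
  \<comment> \<open>Endpoints are read off as \<open>Inf\<close> and \<open>Sup\<close> of the
    interval, the form in which sums over a tagged division telescope.\<close>
  define u v :: "real \<times> real set \<Rightarrow> real" where "u i = Inf (snd i)" and "v i = Sup (snd i)" for i
  have P': "snd i = {u i..v i}" "a \<le> u i" "u i \<le> fst i" "fst i \<le> v i" "v i \<le> b" if "i \<in> P" for i
  proof -
    obtain x k where i: "i = (x, k)" by fastforce
    have xk: "x \<in> k" "k \<subseteq> {a..b}" "\<exists>c d. k = cbox c d"
      using tagged_division_ofD[OF P(1)] that i by auto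
    then obtain c d where k: "k = {c..d}" by auto
    then have "c \<le> d" using xk by auto
    then show "snd i = {u i..v i}" "a \<le> u i" "u i \<le> fst i" "fst i \<le> v i" "v i \<le> b"
      using xk k i by (auto simp: u_def v_def)
  qed
  have fine: "{u i..v i} \<subseteq> \<gamma> (fst i)" if "i \<in> P" for i
    using fineD[OF P(2), of "fst i" "snd i"] that P'(1)[OF that] by (metis prod.collapse)
  have disj: "disjoint_family_on (\<lambda>i. {u i<..<v i}) P"
    unfolding disjoint_family_on_def
  proof (intro ballI impI)
    fix i j assume "i \<in> P" "j \<in> P" "i \<noteq> j"
    then have "interior (snd i) \<inter> interior (snd j) = {}"
      using tagged_division_ofD(5)[OF P(1), of "fst i" "snd i" "fst j" "snd j"] by (metis prod.collapse)
    then show "{u i<..<v i} \<inter> {u j<..<v j} = {}"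
      using P'(1) \<open>i \<in> P\<close> \<open>j \<in> P\<close> by (simp add: interior_atLeastAtMost_real)
  qed
  define B where "B = {i \<in> P. fst i \<in> N}"
  have B: "finite B" "B \<subseteq> P" using \<open>finite P\<close> by (auto simp: B_def)
  have disjB: "disjoint_family_on (\<lambda>i. {u i<..<v i}) B"
    using disj B(2) by (rule disjoint_family_on_mono[rotated])
  have "(\<Sum>i\<in>B. v i - u i) \<le> measure lborel U"
  proof (rule sum_lengths_le_measure[OF B(1) _ _ disjB])
    show "u i \<le> v i" if "i \<in> B" for i using P'[of i] that by (simp add: B_def)
    show "{u i<..<v i} \<subseteq> U" if "i \<in> B" for i
      using fine[of i] that by (auto simp: B_def \<gamma>_def subset_eq)
    show "emeasure lborel U < \<infinity>" using U\<delta> by (auto intro: less_trans)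
  qed (use U in auto)
  also have "\<dots> < \<delta>"
    using U\<delta> \<open>\<delta> > 0\<close> by (simp add: measure_def enn2real_less_iff less_top order_less_trans)
  finally have "(\<Sum>i\<in>B. \<bar>h (v i) - h (u i)\<bar>) < e / 2"
    using P' by (intro \<delta>[OF B(1) _ disjB]) (force simp: B_def)+
  then have bad: "(\<Sum>i\<in>B. h (v i) - h (u i)) \<le> e / 2"
    using sum_mono[of B "\<lambda>i. h (v i) - h (u i)" "\<lambda>i. \<bar>h (v i) - h (u i)\<bar>", OF abs_ge_self] by linarith
  have "(\<Sum>i\<in>P - B. h (v i) - h (u i)) \<le> (\<Sum>i\<in>P - B. \<eta> * (v i - u i))"
  proof (rule sum_mono)
    fix i assume "i \<in> P - B"
    then have i: "i \<in> P" "fst i \<notin> N" by (auto simp: B_def)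
    then have "a \<le> fst i" using P'[OF i(1)] by simp
    moreover have "{u i..v i} \<subseteq> ball (fst i) (d (fst i))"
      using fine[OF i(1)] i(2) \<open>a \<le> fst i\<close> by (simp add: \<gamma>_def)
    ultimately show "h (v i) - h (u i) \<le> \<eta> * (v i - u i)"
      using P'[OF i(1)] i(2) by (intro d(2)[of "fst i"]) (auto simp del: mem_ball)
  qed
  \<comment> \<open>Restoring the nonnegative lengths of the intervals in \<open>B\<close> gives a
    sum over the whole division, which telescopes to \<open>b - a\<close>.\<close>
  also have "\<dots> \<le> (\<Sum>i\<in>P. \<eta> * (v i - u i))"
    using P' \<eta>(1) \<open>finite P\<close> by (intro sum_mono2) (auto intro!: mult_nonneg_nonneg, force)
  also have "\<dots> = \<eta> * (b - a)"
    using additive_tagged_division_1[OF \<open>a \<le> b\<close> P(1), of "\<lambda>x. x"]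
    by (simp add: sum_distrib_left[symmetric] u_def v_def case_prod_unfold)
  finally have good: "(\<Sum>i\<in>P - B. h (v i) - h (u i)) \<le> e / 2" using \<eta>(2) by linarith
  have "h b - h a = (\<Sum>i\<in>P. h (v i) - h (u i))"
    using additive_tagged_division_1[OF \<open>a \<le> b\<close> P(1), of h]
    by (simp add: u_def v_def case_prod_unfold)
  also have "\<dots> = (\<Sum>i\<in>P - B. h (v i) - h (u i)) + (\<Sum>i\<in>B. h (v i) - h (u i))"
    using B \<open>finite P\<close> by (intro sum.subset_diff)
  finally show "h b \<le> h a + e" using good bad by linarith
qed

section \<open>Growth of bounded regularly varying functions\<close>

lemma abs_ln_diff_le:
  fixes x y c :: real
  assumes "0 < c" "c \<le> x" "x \<le> y"
  shows "\<bar>ln y - ln x\<bar> \<le> (y - x) / c"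
proof -
  have "ln y - ln x \<le> (y - x) / x" using assms by (intro ln_diff_le) auto
  also have "\<dots> \<le> (y - x) / c" using assms by (intro divide_left_mono) auto
  finally show ?thesis using assms by simp
qed

text \<open>A Potter-type bound: the logarithmic derivative of \<open>f\<close> is at most
  \<open>\<alpha> / t\<close> almost everywhere, and integrating this from \<open>a\<close> to
  \<open>b\<close> would give \<open>\<alpha> * ln (b / a)\<close>. Absolute continuity is what
  makes the a.e. information sufficient.\<close>

lemma bounded_regularly_varying_growth:
  assumes "bounded_regularly_varying \<alpha> f" "\<alpha> \<ge> 0"
  obtains t\<^sub>0 where "t\<^sub>0 > 0" "\<And>a b. t\<^sub>0 \<le> a \<Longrightarrow> a \<le> b \<Longrightarrow> f b \<le> (b / a) powr \<alpha> * f a"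
proof -
  obtain t\<^sub>0 where pos: "\<And>t. t > 0 \<Longrightarrow> f t > 0" and "t\<^sub>0 > 0" and mono: "mono_on {t\<^sub>0..} f"
    and ac: "\<And>a b. t\<^sub>0 \<le> a \<Longrightarrow> a \<le> b \<Longrightarrow> absolutely_continuous_on_Icc a b f"
    and ae: "AE t in lborel. t \<ge> t\<^sub>0 \<longrightarrow> (\<exists>D. (f has_real_derivative D) (at t) \<and> t * D / f t \<le> \<alpha>)"
    using assms unfolding bounded_regularly_varying_def by blast
  show thesis
  proof (rule that[OF \<open>t\<^sub>0 > 0\<close>])
    fix a b assume ab: "t\<^sub>0 \<le> a" "a \<le> b"
    then have "a > 0" "f a > 0" "f b > 0" using \<open>t\<^sub>0 > 0\<close> pos by auto
    define h where "h t = ln (f t) - \<alpha> * ln t" for t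
    \<comment> \<open>This adds the Lipschitz constants of \<open>ln\<close> on
      \<open>[f a, \<infinity>)\<close> and of \<open>\<alpha> * ln\<close> on
      \<open>[a, \<infinity>)\<close>. The first interval is the right one because monotonicity
      keeps \<open>f\<close> above \<open>f a\<close>.\<close>
    define L where "L = 1 / f a + \<alpha> / a"
    have "L > 0" using \<open>a > 0\<close> \<open>f a > 0\<close> \<open>\<alpha> \<ge> 0\<close> by (simp add: L_def add_pos_nonneg)
    have "absolutely_continuous_on_Icc a b h"
    proof (rule absolutely_continuous_on_Icc_dominated[OF ac[OF ab] \<open>L > 0\<close>])
      fix u v assume uv: "a \<le> u" "u \<le> v" "v \<le> b"
      then have fuv: "f a \<le> f u" "f u \<le> f v" using ab by (auto intro: mono_onD[OF mono])
      have "\<bar>h v - h u\<bar> \<le> \<bar>ln (f v) - ln (f u)\<bar> + \<alpha> * \<bar>ln v - ln u\<bar>"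
        using abs_triangle_ineq4[of "ln (f v) - ln (f u)" "\<alpha> * (ln v - ln u)"] \<open>\<alpha> \<ge> 0\<close>
        unfolding h_def abs_mult by (simp add: right_diff_distrib)
      also have "\<dots> \<le> (f v - f u) / f a + \<alpha> * ((v - u) / a)"
        using uv fuv \<open>a > 0\<close> \<open>f a > 0\<close> \<open>\<alpha> \<ge> 0\<close>
        by (intro add_mono mult_left_mono abs_ln_diff_le) auto
      also have "\<dots> \<le> L * (f v - f u) + L * (v - u)"
      proof (intro add_mono)
        have "1 / f a \<le> L" "\<alpha> / a \<le> L" using \<open>a > 0\<close> \<open>f a > 0\<close> \<open>\<alpha> \<ge> 0\<close> by (auto simp: L_def)
        from mult_right_mono[OF this(1), of "f v - f u"] mult_right_mono[OF this(2), of "v - u"]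
        show "(f v - f u) / f a \<le> L * (f v - f u)" "\<alpha> * ((v - u) / a) \<le> L * (v - u)"
          using uv fuv by auto
      qed
      finally show "\<bar>h v - h u\<bar> \<le> L * (\<bar>f v - f u\<bar> + (v - u))"
        using fuv by (simp add: algebra_simps)
    qed
    moreover have "AE t in lborel. a \<le> t \<longrightarrow> (\<exists>D\<le>0. (h has_real_derivative D) (at t))"
      using ae
    proof eventually_elim
      case (elim t)
      show ?case
      proof
        assume "a \<le> t"
        then have t: "t > 0" "f t > 0" "t \<ge> t\<^sub>0" using ab \<open>t\<^sub>0 > 0\<close> pos by auto
        then obtain D where D: "(f has_real_derivative D) (at t)" "t * D / f t \<le> \<alpha>"
          using elim by blast
        \<comment> \<open>The sign of this derivative is the hypothesis
          \<open>t * D / f t \<le> \<alpha>\<close> divided by \<open>t\<close>.\<close>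
        have "(h has_real_derivative D / f t - \<alpha> / t) (at t)"
          unfolding h_def using t by (auto intro!: derivative_eq_intros D(1))
        moreover have "D / f t - \<alpha> / t \<le> 0"
          using D(2) t by (simp add: field_simps)
        ultimately show "\<exists>D\<le>0. (h has_real_derivative D) (at t)" by blast
      qed
    qed
    ultimately have "h b \<le> h a"
      by (rule absolutely_continuous_on_Icc_nonincreasing[OF ab(2)])
    then have "ln (f b) \<le> \<alpha> * ln (b / a) + ln (f a)"
      using \<open>a > 0\<close> ab by (simp add: h_def ln_div algebra_simps)
    also have "\<dots> = ln ((b / a) powr \<alpha> * f a)"
      using \<open>a > 0\<close> \<open>f a > 0\<close> ab by (simp add: ln_mult ln_powr)
    finally show "f b \<le> (b / a) powr \<alpha> * f a"
      using \<open>a > 0\<close> \<open>f a > 0\<close> \<open>f b > 0\<close> ab by (subst (asm) ln_le_cancel_iff) auto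
  qed
qed

text \<open>About half of the terms of the sum are comparable to the last one, so the sum is at
  least a multiple of \<open>n\<close> times the last term. In (b) this replaces
  \<open>f m / F m\<close> by a multiple of \<open>1 / (m * g m)\<close>.\<close>

lemma last_term_le_sum:
  assumes f: "bounded_regularly_varying \<alpha> f" and g: "bounded_regularly_varying \<alpha> g" and "\<alpha> \<ge> 0"
  obtains C where "C > 0"
    "\<And>n::nat. n \<ge> 1 \<Longrightarrow> real n * (f (real n) * g (real n)) \<le> C * (\<Sum>m=1..n. f (real m) * g (real m))"
proof -
  obtain s where s: "s > 0" "\<And>a b. s \<le> a \<Longrightarrow> a \<le> b \<Longrightarrow> f b \<le> (b / a) powr \<alpha> * f a"
    using bounded_regularly_varying_growth[OF f \<open>\<alpha> \<ge> 0\<close>] by blast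
  obtain t where t: "t > 0" "\<And>a b. t \<le> a \<Longrightarrow> a \<le> b \<Longrightarrow> g b \<le> (b / a) powr \<alpha> * g a"
    using bounded_regularly_varying_growth[OF g \<open>\<alpha> \<ge> 0\<close>] by blast
  have fpos: "f t > 0" and gpos: "g t > 0" if "t > 0" for t
    using f g that by (auto simp: bounded_regularly_varying_def)
  \<comment> \<open>Beyond \<open>r\<close> both growth bounds apply, and \<open>q\<close> is the
    combined loss of \<open>f\<close> and \<open>g\<close> when the argument is halved. In
    \<open>C\<close>, the entry \<open>2 * r\<close> handles \<open>n \<le> 2 * r\<close>, where the
    last term alone suffices; \<open>2 * q\<close> handles larger \<open>n\<close>, the 2 reflecting
    that only half of the terms are kept.\<close>
  define r where "r = max s t"
  define q :: real where "q = 2 powr \<alpha> * 2 powr \<alpha>"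
  define C where "C = max (2 * r) (2 * q)"
  have "r > 0" "q > 0" using s by (auto simp: r_def q_def)
  show thesis
  proof (rule that[of C])
    show "C > 0" using \<open>r > 0\<close> by (simp add: C_def)
    fix n :: nat assume "n \<ge> 1"
    let ?F = "\<Sum>m=1..n. f (real m) * g (real m)"
    have "?F > 0" using \<open>n \<ge> 1\<close> fpos gpos by (intro sum_pos) auto
    have fgn: "f (real n) * g (real n) > 0" using \<open>n \<ge> 1\<close> fpos gpos by simp
    show "real n * (f (real n) * g (real n)) \<le> C * ?F"
    proof (cases "real n \<le> 2 * r")
      case True
      have "f (real n) * g (real n) \<le> ?F"
        using \<open>n \<ge> 1\<close> fpos gpos by (intro member_le_sum) (auto intro!: mult_nonneg_nonneg less_imp_le)
      then have "real n * (f (real n) * g (real n)) \<le> C * ?F"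
        using True fgn \<open>r > 0\<close> by (intro mult_mono) (auto simp: C_def)
      then show ?thesis .
    next
      case False
      \<comment> \<open>Subtracting \<open>n div 2\<close> rounds the lower end up, so every index
        is at least \<open>n / 2\<close>, hence above \<open>r\<close>, for either parity; there are
        \<open>n div 2 + 1 \<ge> n / 2\<close> indices.\<close>
      let ?J = "{n - n div 2..n}"
      have J: "?J \<subseteq> {1..n}" using \<open>n \<ge> 1\<close> by auto
      have "f (real n) * g (real n) \<le> q * (f (real k) * g (real k))" if "k \<in> ?J" for k
      proof -
        have k: "real n / 2 \<le> real k" "k \<le> n" using that by (auto simp: field_simps)
        then have "real k \<ge> s" "real k \<ge> t" "real k > 0"
          using False \<open>r > 0\<close> by (auto simp: r_def)
        have "(real n / real k) powr \<alpha> \<le> 2 powr \<alpha>"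
          using k \<open>real k > 0\<close> \<open>\<alpha> \<ge> 0\<close> by (intro powr_mono2) (auto simp: field_simps)
        then have "(real n / real k) powr \<alpha> * f (real k) \<le> 2 powr \<alpha> * f (real k)"
          "(real n / real k) powr \<alpha> * g (real k) \<le> 2 powr \<alpha> * g (real k)"
          using fpos[OF \<open>real k > 0\<close>] gpos[OF \<open>real k > 0\<close>] by (auto intro!: mult_right_mono)
        then have "f (real n) \<le> 2 powr \<alpha> * f (real k)" "g (real n) \<le> 2 powr \<alpha> * g (real k)"
          using s(2)[of k n] t(2)[of k n] k \<open>real k \<ge> s\<close> \<open>real k \<ge> t\<close> by auto
        then have "f (real n) * g (real n) \<le> (2 powr \<alpha> * f (real k)) * (2 powr \<alpha> * g (real k))"
          using fpos[of n] gpos[of n] fpos[of k] gpos[of k] \<open>real k > 0\<close> \<open>n \<ge> 1\<close>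
          by (intro mult_mono) auto
        then show ?thesis by (simp add: q_def algebra_simps)
      qed
      then have "(\<Sum>k\<in>?J. f (real n) * g (real n)) \<le> (\<Sum>k\<in>?J. q * (f (real k) * g (real k)))"
        by (rule sum_mono)
      also have "\<dots> = q * (\<Sum>k\<in>?J. f (real k) * g (real k))" by (simp add: sum_distrib_left)
      also have "\<dots> \<le> q * ?F"
        using J \<open>q > 0\<close> fpos gpos
        by (intro mult_left_mono sum_mono2) (auto intro!: mult_nonneg_nonneg less_imp_le)
      finally have "real (card ?J) * (f (real n) * g (real n)) \<le> q * ?F" by simp
      moreover have "real n / 2 \<le> real (card ?J)" by (simp add: field_simps)
      then have "real n / 2 * (f (real n) * g (real n)) \<le> real (card ?J) * (f (real n) * g (real n))"
        using fgn by (intro mult_right_mono) auto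
      ultimately have "real n * (f (real n) * g (real n)) \<le> 2 * q * ?F" by simp
      also have "\<dots> \<le> C * ?F" using \<open>?F > 0\<close> by (intro mult_right_mono) (auto simp: C_def)
      finally show ?thesis .
    qed
  qed
qed

section \<open>Powers of operators\<close>

lemma bounded_linear_funpow:
  fixes T :: "'a::real_normed_vector \<Rightarrow> 'a"
  assumes "bounded_linear T"
  shows "bounded_linear (T ^^ n)"
proof (induction n)
  case 0
  show ?case using bounded_linear_ident by (simp add: id_def)
next
  case (Suc n)
  then show ?case using bounded_linear_compose[OF assms Suc] by (simp add: o_def)
qed

text \<open>Each earlier orbit point dominates the \<open>n\<close>-th up to the factor
  \<open>K\<close>, so the weighted sum is at least \<open>F\<close> times the \<open>p\<close>-th
  power of the \<open>n\<close>-th norm over \<open>K\<close>. The index \<open>n\<close> is fixed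
  and \<open>c\<close> stands for \<open>G n\<close>.\<close>

lemma onorm_le_of_weighted_sum:
  fixes T :: "'x::real_normed_vector \<Rightarrow> 'x" and S :: "'y::real_normed_vector \<Rightarrow> 'x" and f :: "nat \<Rightarrow> real"
  assumes T: "bounded_linear T" and "p > 0"
    and bdd: "bdd_above (range (\<lambda>n. onorm (T ^^ n)))"
    and f: "\<And>m. m \<ge> 1 \<Longrightarrow> f m > 0" and "c > 0" and "n \<ge> 1"
    and sum_le: "\<And>y. (\<Sum>m=1..n. f m * norm ((T ^^ m) (S y)) powr p) \<le> c * norm y powr p"
  shows "onorm ((T ^^ n) \<circ> S) \<le> (SUP n. onorm (T ^^ n)) * c powr (1 / p) / (\<Sum>m=1..n. f m) powr (1 / p)"
proof -
  define K where "K = (SUP n. onorm (T ^^ n))"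
  define F where "F = (\<Sum>m=1..n. f m)"
  have onorm_le: "onorm (T ^^ k) \<le> K" for k
    unfolding K_def using bdd by (intro cSUP_upper) auto
  have "K \<ge> 0" using onorm_le[of 0] onorm_pos_le[OF bounded_linear_funpow[OF T, of 0]] by linarith
  have "F > 0" unfolding F_def using \<open>n \<ge> 1\<close> f by (intro sum_pos) auto
  have "norm ((T ^^ n) (S y)) \<le> K * c powr (1 / p) / F powr (1 / p) * norm y" for y
  proof -
    let ?x = "norm ((T ^^ n) (S y))"
    have step: "?x \<le> K * norm ((T ^^ m) (S y))" if "m \<le> n" for m
    proof -
      have "(T ^^ n) (S y) = (T ^^ (n - m)) ((T ^^ m) (S y))"
        using that by (metis comp_apply funpow_add le_add_diff_inverse2)
      also have "norm \<dots> \<le> onorm (T ^^ (n - m)) * norm ((T ^^ m) (S y))"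
        by (rule onorm[OF bounded_linear_funpow[OF T]])
      also have "\<dots> \<le> K * norm ((T ^^ m) (S y))"
        by (intro mult_right_mono onorm_le) auto
      finally show ?thesis .
    qed
    have "F * ?x powr p = (\<Sum>m=1..n. f m * ?x powr p)" by (simp add: F_def sum_distrib_right)
    also have "\<dots> \<le> (\<Sum>m=1..n. f m * (K * norm ((T ^^ m) (S y))) powr p)"
      using step f \<open>p > 0\<close> by (intro sum_mono mult_left_mono powr_mono2) (auto intro: less_imp_le)
    also have "\<dots> = K powr p * (\<Sum>m=1..n. f m * norm ((T ^^ m) (S y)) powr p)"
      using \<open>K \<ge> 0\<close> by (simp add: powr_mult sum_distrib_left mult_ac)
    also have "\<dots> \<le> K powr p * (c * norm y powr p)"
      using sum_le by (intro mult_left_mono) auto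
    finally have "?x powr p \<le> K powr p * (c * norm y powr p) / F"
      using \<open>F > 0\<close> by (simp add: field_simps)
    \<comment> \<open>Taking \<open>p\<close>-th roots also covers vanishing norms, thanks to the
      convention \<open>0 powr a = 0\<close>.\<close>
    then have "(?x powr p) powr (1 / p) \<le> (K powr p * (c * norm y powr p) / F) powr (1 / p)"
      using \<open>p > 0\<close> by (intro powr_mono2) auto
    then show ?thesis
      using \<open>p > 0\<close> \<open>F > 0\<close> \<open>K \<ge> 0\<close> \<open>c > 0\<close>
      by (simp add: powr_mult powr_divide powr_powr mult_ac)
  qed
  then show ?thesis
    unfolding K_def[symmetric] F_def[symmetric] using \<open>K \<ge> 0\<close> by (intro onorm_bound) auto
qed

text \<open>The big-O bound says that \<open>a n * b n\<close> is eventually bounded, and an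
  eventually bounded sequence is bounded, the finitely many exceptions being absorbed in
  \<open>M\<close>. Index 0 is excluded since in the application \<open>b 0\<close> is a power of an
  empty sum, hence 0.\<close>

lemma bigo_inverse_uniform:
  fixes a b :: "nat \<Rightarrow> real"
  assumes "a \<in> O(\<lambda>n. 1 / b n)" and b: "\<And>n. n \<ge> 1 \<Longrightarrow> b n > 0"
  obtains M where "M > 0" "\<And>n. n \<ge> 1 \<Longrightarrow> a n \<le> M / b n"
proof -
  obtain c where "eventually (\<lambda>n. norm (a n) \<le> c * norm (1 / b n)) sequentially"
    using assms(1) by (auto elim: landau_o.bigE)
  then have "eventually (\<lambda>n. norm (a n * b n) \<le> c) sequentially"
    using eventually_ge_at_top[of 1]
  proof eventually_elim
    case (elim n)
    then show ?case using b[of n] by (simp add: abs_mult field_simps)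
  qed
  then have "Bseq (\<lambda>n. a n * b n)"
    by (rule BfunI)
  then obtain M where "M > 0" "\<And>n. norm (a n * b n) \<le> M" by (auto elim: BseqE)
  then show thesis using b by (intro that[of M]) (auto simp: field_simps abs_le_iff)
qed

text \<open>The estimate is termwise: the decay rate bounds the \<open>m\<close>-th term by a
  multiple of \<open>f m / F m\<close>, and the last-term comparison turns this into the
  \<open>m\<close>-th term of \<open>G\<close>.\<close>

lemma weighted_sum_le_of_bigo:
  fixes T :: "'x::real_normed_vector \<Rightarrow> 'x" and S :: "'y::real_normed_vector \<Rightarrow> 'x"
  assumes T: "bounded_linear T" and S: "bounded_linear S" and "p > 0" and "\<alpha> \<ge> 0"
    and f: "bounded_regularly_varying \<alpha> f" and g: "bounded_regularly_varying \<alpha> g"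
    and bigo: "(\<lambda>n. onorm ((T ^^ n) \<circ> S)) \<in> O(\<lambda>n. 1 / (\<Sum>m=1..n. f (real m) * g (real m)) powr (1 / p))"
  obtains C where "C > 0"
    "\<And>n y. (\<Sum>m=1..n. f (real m) * norm ((T ^^ m) (S y)) powr p)
       \<le> C * (\<Sum>m=1..n. 1 / (real m * g (real m))) * norm y powr p"
proof -
  define F where "F n = (\<Sum>m=1..n. f (real m) * g (real m))" for n :: nat
  have fpos: "f t > 0" and gpos: "g t > 0" if "t > 0" for t
    using f g that by (auto simp: bounded_regularly_varying_def)
  have Fpos: "F n > 0" if "n \<ge> 1" for n
    unfolding F_def using that fpos gpos by (intro sum_pos) auto
  obtain C where "C > 0" and C: "\<And>n. n \<ge> 1 \<Longrightarrow> real n * (f (real n) * g (real n)) \<le> C * F n"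
    unfolding F_def using last_term_le_sum[OF f g \<open>\<alpha> \<ge> 0\<close>] by blast
  have "F n powr (1 / p) > 0" if "n \<ge> 1" for n using Fpos[OF that] by simp
  from bigo_inverse_uniform[OF bigo[folded F_def] this]
  obtain M where "M > 0" and M: "\<And>n. n \<ge> 1 \<Longrightarrow> onorm ((T ^^ n) \<circ> S) \<le> M / F n powr (1 / p)"
    by blast
  show thesis
  \<comment> \<open>\<open>M powr p\<close> comes from raising the decay bound to the power
    \<open>p\<close>, \<open>C\<close> from the last-term comparison; neither depends on
    \<open>n\<close> or \<open>y\<close>.\<close>
  proof (rule that[of "M powr p * C"])
    show "M powr p * C > 0" using \<open>M > 0\<close> \<open>C > 0\<close> by simp
    fix n :: nat and y
    have "f (real m) * norm ((T ^^ m) (S y)) powr p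
        \<le> M powr p * C * (1 / (real m * g (real m))) * norm y powr p" if "m \<in> {1..n}" for m
    proof -
      have m: "m \<ge> 1" "real m > 0" using that by auto
      have "norm ((T ^^ m) (S y)) \<le> onorm ((T ^^ m) \<circ> S) * norm y"
        using onorm[OF bounded_linear_compose[OF bounded_linear_funpow[OF T, of m] S], of y]
        by (simp add: o_def)
      also have "\<dots> \<le> M / F m powr (1 / p) * norm y"
        using M[OF m(1)] by (rule mult_right_mono) simp
      finally have "norm ((T ^^ m) (S y)) powr p \<le> (M / F m powr (1 / p) * norm y) powr p"
        using \<open>p > 0\<close> by (intro powr_mono2) auto
      also have "\<dots> = M powr p / F m * norm y powr p"
        using \<open>p > 0\<close> \<open>M > 0\<close> Fpos[OF m(1)] by (simp add: powr_mult powr_divide powr_powr)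
      finally have "f (real m) * norm ((T ^^ m) (S y)) powr p
          \<le> f (real m) * (M powr p / F m * norm y powr p)"
        using fpos[OF m(2)] by (intro mult_left_mono) auto
      also have "\<dots> = M powr p * (f (real m) / F m) * norm y powr p" by simp
      \<comment> \<open>Dividing \<open>m * f m * g m \<le> C * F m\<close> by the positive number
        \<open>m * g m * F m\<close> gives the bound on \<open>f m / F m\<close>.\<close>
      also have "\<dots> \<le> M powr p * (C * (1 / (real m * g (real m)))) * norm y powr p"
        using C[OF m(1)] Fpos[OF m(1)] gpos[OF m(2)] m
        by (intro mult_right_mono mult_left_mono) (auto simp: field_simps)
      finally show ?thesis by (simp add: mult_ac)
    qed
    then show "(\<Sum>m=1..n. f (real m) * norm ((T ^^ m) (S y)) powr p)
        \<le> M powr p * C * (\<Sum>m=1..n. 1 / (real m * g (real m))) * norm y powr p"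
      unfolding sum_distrib_left sum_distrib_right by (rule sum_mono)
  qed
qed

theorem proposition6p1:
  fixes T :: "'x::complex_banach \<Rightarrow> 'x"
    and S :: "'y::complex_banach \<Rightarrow> 'x"
    and p :: real
  assumes "bounded_clinear T" and "bounded_clinear S" and "p > 0"
  shows
    "(power_bounded T \<longrightarrow>
       (\<forall>(f :: nat \<Rightarrow> real) (G :: nat \<Rightarrow> real).
          (\<forall>n\<ge>1. f n > 0) \<longrightarrow> (\<forall>n\<ge>1. G n > 0) \<longrightarrow>
          (\<forall>n\<ge>1. \<forall>y. (\<Sum>m=1..n. f m * norm ((T ^^ m) (S y)) powr p) \<le> G n * norm y powr p) \<longrightarrow>
          (let K = (SUP n. onorm (T ^^ n));
               F = (\<lambda>n. \<Sum>m=1..n. f m)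
           in \<forall>n\<ge>1. onorm ((T ^^ n) \<circ> S) \<le> K * G n powr (1 / p) / F n powr (1 / p)))) \<and>
     (\<forall>(f :: real \<Rightarrow> real) (g :: real \<Rightarrow> real) (\<alpha> :: real).
       \<alpha> \<ge> 0 \<longrightarrow> bounded_regularly_varying \<alpha> f \<longrightarrow> bounded_regularly_varying \<alpha> g \<longrightarrow>
       (let F = (\<lambda>n::nat. \<Sum>m=1..n. f (real m) * g (real m));
            G = (\<lambda>n::nat. \<Sum>m=1..n. 1 / (real m * g (real m)))
        in (\<lambda>n. onorm ((T ^^ n) \<circ> S)) \<in> O(\<lambda>n. 1 / F n powr (1 / p)) \<longrightarrow>
           (\<exists>C>0. \<forall>n\<ge>1. \<forall>y.
              (\<Sum>m=1..n. f (real m) * norm ((T ^^ m) (S y)) powr p) \<le> C * G n * norm y powr p)))"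
proof -
  have T: "bounded_linear T" and S: "bounded_linear S"
    using assms by (auto simp: bounded_clinear_def)
  show ?thesis
    unfolding Let_def power_bounded_def
  proof (intro conjI allI impI, goal_cases)
    case (1 f G n)
    then show ?case by (intro onorm_le_of_weighted_sum[OF T \<open>p > 0\<close>]) auto
  next
    case (2 f g \<alpha>)
    from weighted_sum_le_of_bigo[OF T S \<open>p > 0\<close> this]
    obtain C where "C > 0" "\<And>n y. (\<Sum>m=1..n. f (real m) * norm ((T ^^ m) (S y)) powr p)
       \<le> C * (\<Sum>m=1..n. 1 / (real m * g (real m))) * norm y powr p" by blast
    then show ?case by blast
  qed
qed

end
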